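(* Let $N\geq 2$, $R>0$, and let $B_R(0)$ be the open ball of center $0$ and radius $R$ in $\mathbb{R}^N$. Let $g:\mathbb{R}\to\mathbb{R}$ be locally Lipschitz continuous and let $u$ be a large solution of $-\Delta u+g(u)=0$ in $B_R(0)$, i.e. a solution such that $\lim_{|x|\to R}u(x)=\infty$. Assume that $$\text{(i)}\quad \lim_{|x|\to R}\frac{\partial u}{\partial r}(x)=\infty,\qquad \text{(ii)}\quad |\nabla_\tau u(x)|=o\left(\frac{\partial u}{\partial r}(x)\right)\ \text{ as } |x|\to R.$$ Then $u$ is radial and $\frac{\partial u}{\partial r}(x)>0$ for every $x\in B_R(0)\setminus\{0\}$.
   Context: A solution is a classical ($C^2$) solution in the open ball. For $x\neq 0$, $\frac{\partial u}{\partial r}(x)=\langle Du(x),x/|x|\rangle$ is the radial derivative of $u$ and $\nabla_\tau u(x)=Du(x)-|x|^{-2}\langle Du(x),x\rangle\,x$ is its tangential gradient. Limits and the $o(\cdot)$ as $|x|\to R$ are for $x\in B_R(0)$ with $|x|\to R$, hence uniform with respect to the direction $x/|x|$. A function is radial if its value at $x$ depends only on $|x|$. *)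

theory Defs
  imports
    "HOL-Analysis.Analysis"
    "HOL-Library.Landau_Symbols"
    "HOL-Library.Going_To_Filter"
begin

definition grad :: "('a::euclidean_space \<Rightarrow> real) \<Rightarrow> 'a \<Rightarrow> 'a"
  where "grad u x = (THE D. GDERIV u x :> D)"

definition divergence :: "('a::euclidean_space \<Rightarrow> 'a) \<Rightarrow> 'a \<Rightarrow> real"
  where "divergence F x = (\<Sum>b\<in>Basis. frechet_derivative F (at x) b \<bullet> b)"

definition laplacian :: "('a::euclidean_space \<Rightarrow> real) \<Rightarrow> 'a \<Rightarrow> real"
  where "laplacian u = divergence (grad u)"

(* Meant for open S.  In finite dimension, continuity of the second derivative along every fixed
   direction v is the same as continuity in the operator norm. *)
definition C2_on :: "'a::euclidean_space set \<Rightarrow> ('a \<Rightarrow> real) \<Rightarrow> bool"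
  where "C2_on S u \<longleftrightarrow>
    (\<forall>x\<in>S. u differentiable (at x)) \<and>
    (\<forall>x\<in>S. grad u differentiable (at x)) \<and>
    (\<forall>v. continuous_on S (\<lambda>x. frechet_derivative (grad u) (at x) v))"

definition radial_deriv :: "('a::euclidean_space \<Rightarrow> real) \<Rightarrow> 'a \<Rightarrow> real"
  where "radial_deriv u x = grad u x \<bullet> (x /\<^sub>R norm x)"

definition tangential_grad :: "('a::euclidean_space \<Rightarrow> real) \<Rightarrow> 'a \<Rightarrow> 'a"
  where "tangential_grad u x = grad u x - ((grad u x \<bullet> x) / (norm x)\<^sup>2) *\<^sub>R x"

(* |x| tends to R with x in the open ball; uniform in the direction of x. *)
definition to_sphere :: "real \<Rightarrow> 'a::euclidean_space filter"
  where "to_sphere R = (norm going_to nhds R within ball 0 R)"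

(* The library predicate is for a family of functions with a parameter; here the family is constant. *)
definition locally_lipschitz :: "(real \<Rightarrow> real) \<Rightarrow> bool"
  where "locally_lipschitz g \<longleftrightarrow> local_lipschitz (UNIV :: real set) UNIV (\<lambda>_. g)"

definition classical_solution :: "(real \<Rightarrow> real) \<Rightarrow> 'a::euclidean_space set \<Rightarrow> ('a \<Rightarrow> real) \<Rightarrow> bool"
  where "classical_solution g S u \<longleftrightarrow>
    C2_on S u \<and> (\<forall>x\<in>S. - laplacian u x + g (u x) = 0)"

definition large_solution :: "(real \<Rightarrow> real) \<Rightarrow> real \<Rightarrow> ('a::euclidean_space \<Rightarrow> real) \<Rightarrow> bool"
  where "large_solution g R u \<longleftrightarrow>
    classical_solution g (ball 0 R) u \<and> filterlim u at_top (to_sphere R)"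

definition radial_on :: "'a::euclidean_space set \<Rightarrow> ('a \<Rightarrow> real) \<Rightarrow> bool"
  where "radial_on S u \<longleftrightarrow> (\<forall>x\<in>S. \<forall>y\<in>S. norm x = norm y \<longrightarrow> u x = u y)"

lemma grad_eqI:
  fixes u :: "'a::euclidean_space \<Rightarrow> real"
  assumes "GDERIV u x :> D"
  shows "grad u x = D"
  unfolding grad_def
proof (rule the_equality)
  show "GDERIV u x :> D" by (fact assms)
next
  fix E assume "GDERIV u x :> E"
  then have "(\<lambda>h. h \<bullet> E) = (\<lambda>h. h \<bullet> D)"
    using assms has_derivative_unique unfolding gderiv_def by blast
  then show "E = D"
    by (metis vector_eq_ldot)
qed

lemma GDERIV_grad:
  fixes u :: "'a::euclidean_space \<Rightarrow> real"
  assumes "u differentiable (at x)"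
  shows "GDERIV u x :> grad u x"
proof -
  obtain f' where f': "(u has_derivative f') (at x)"
    using assms unfolding differentiable_def by blast
  then have "linear f'"
    by (rule has_derivative_linear)
  then have "f' = (\<lambda>h. h \<bullet> adjoint f' 1)"
    by (simp add: fun_eq_iff adjoint_works)
  with f' have "GDERIV u x :> adjoint f' 1"
    unfolding gderiv_def by metis
  then show ?thesis
    using grad_eqI by metis
qed

lemma eventually_to_sphere:
  fixes P :: "'a::euclidean_space \<Rightarrow> bool"
  shows "eventually P (to_sphere R) \<longleftrightarrow>
    (\<exists>d>0. \<forall>x. R - d < norm x \<and> norm x < R \<longrightarrow> P x)"
proof -
  have "eventually P (to_sphere R) \<longleftrightarrow>
      (\<exists>Q. eventually Q (nhds R) \<and> (\<forall>x\<in>ball 0 R. Q (norm x) \<longrightarrow> P x))"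
    unfolding to_sphere_def going_to_within_def eventually_inf_principal eventually_filtercomap
    by blast
  also have "\<dots> \<longleftrightarrow> (\<exists>d>0. \<forall>x. R - d < norm x \<and> norm x < R \<longrightarrow> P x)"
  proof (intro iffI; elim exE conjE)
    fix Q assume "eventually Q (nhds R)" and P: "\<forall>x\<in>ball 0 R. Q (norm x) \<longrightarrow> P x"
    then obtain d where "d > 0" "\<And>y. dist y R < d \<Longrightarrow> Q y"
      unfolding eventually_nhds_metric by blast
    then show "\<exists>d>0. \<forall>x. R - d < norm x \<and> norm x < R \<longrightarrow> P x"
      using P by (intro exI[of _ d]) (auto simp: dist_real_def)
  next
    fix d :: real assume "d > 0" and "\<forall>x. R - d < norm x \<and> norm x < R \<longrightarrow> P x"
    then show "\<exists>Q. eventually Q (nhds R) \<and> (\<forall>x\<in>ball 0 R. Q (norm x) \<longrightarrow> P x)"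
      by (intro exI[of _ "\<lambda>y. R - d < y"])
         (auto intro!: eventually_nhds_in_open[of "{R - d<..}", simplified])
  qed
  finally show ?thesis .
qed

end

(* Moving planes.  Fix a unit vector e and reflect the cap {x. x.e > s} across the hyperplane x.e = s.
   The difference w of u and its reflection satisfies lap w <= K w locally in the cap wherever w >= 0,
   because g is locally Lipschitz, so the strong maximum principle and the Hopf lemma apply.
   Let s be the supremum of the positive positions at which the strict reflection inequality fails,
   and take a limit point l of corresponding bad points.  If l lies in the open cap, the strict
   inequality at s contradicts continuity; if l is on the sphere beyond the hyperplane, the blow-up
   of u does.  If l lies on the hyperplane, then grad u . e > 0 near l, by the Hopf lemma inside
   the ball and by hypotheses (i) and (ii) at the sphere, although u fails to increase along short
   segments parallel to e near l.  The case s = R is of this last kind, so there is no separate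
   starting step.  Letting s tend to 0 in every direction gives radial symmetry, and the
   Hopf lemma with e = x/|x| and s = |x| gives the sign of the radial derivative. *)

theory Submission
  imports Defs
begin

section \<open>Derivatives along lines and at a local minimum\<close>

lemma has_real_derivative_along_line:
  fixes u :: "'a::euclidean_space \<Rightarrow> real"
  assumes "GDERIV u (x + t *\<^sub>R b) :> D"
  shows "((\<lambda>s. u (x + s *\<^sub>R b)) has_real_derivative D \<bullet> b) (at t)"
proof -
  have "((\<lambda>s. x + s *\<^sub>R b) has_derivative (\<lambda>s. s *\<^sub>R b)) (at t)"
    by (auto intro!: derivative_eq_intros)
  then have "((\<lambda>s. u (x + s *\<^sub>R b)) has_derivative (\<lambda>s. (s *\<^sub>R b) \<bullet> D)) (at t)"
    using assms unfolding gderiv_def by (rule has_derivative_compose)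
  moreover have "(\<lambda>s. (s *\<^sub>R b) \<bullet> D) = (*) (D \<bullet> b)"
    by (simp add: fun_eq_iff inner_commute)
  ultimately show ?thesis
    by (simp add: has_field_derivative_def)
qed

lemma increasing_along_segment:
  fixes u :: "'a::euclidean_space \<Rightarrow> real"
  assumes "t > 0"
    and "\<And>s. 0 \<le> s \<Longrightarrow> s \<le> t \<Longrightarrow> GDERIV u (x + s *\<^sub>R e) :> G (x + s *\<^sub>R e)"
    and "\<And>s. 0 \<le> s \<Longrightarrow> s \<le> t \<Longrightarrow> G (x + s *\<^sub>R e) \<bullet> e > 0"
  shows "u x < u (x + t *\<^sub>R e)"
proof -
  have "(\<lambda>s. u (x + s *\<^sub>R e)) 0 < (\<lambda>s. u (x + s *\<^sub>R e)) t"
  proof (rule DERIV_pos_imp_increasing[OF \<open>t > 0\<close>])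
    fix s assume "0 \<le> s" "s \<le> t"
    then show "\<exists>y. ((\<lambda>s. u (x + s *\<^sub>R e)) has_real_derivative y) (at s) \<and> 0 < y"
      using has_real_derivative_along_line assms(2,3) by blast
  qed
  then show ?thesis by simp
qed

text \<open>Restrict \<open>v\<close> to the line through \<open>x\<close> in direction
  \<open>b\<close>. At the minimum the slope vanishes, so a negative second derivative would make
  the slope negative just to the right, and by the mean value theorem \<open>v\<close> would drop
  below its minimum.\<close>

lemma second_derivative_nonneg_at_local_min:
  fixes v :: "'a::euclidean_space \<Rightarrow> real"
  assumes "r > 0"
    and G: "\<And>y. y \<in> ball x r \<Longrightarrow> GDERIV v y :> G y"
    and H: "(G has_derivative H) (at x)"
    and min: "\<And>y. y \<in> ball x r \<Longrightarrow> v x \<le> v y"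
  shows "H b \<bullet> b \<ge> 0"
proof (rule ccontr)
  assume neg: "\<not> H b \<bullet> b \<ge> 0"
  \<comment> \<open>Keeps \<open>x + t *\<^sub>R b\<close> in the ball for |t| < \<delta>; the
    summand 1 covers \<open>b = 0\<close>.\<close>
  define \<delta> where "\<delta> = r / (norm b + 1)"
  have b: "norm b + 1 > 0" by (simp add: add_nonneg_pos)
  then have "\<delta> > 0" using \<open>r > 0\<close> by (simp add: \<delta>_def)
  have inb: "x + t *\<^sub>R b \<in> ball x r" if "\<bar>t\<bar> < \<delta>" for t
  proof -
    have "\<bar>t\<bar> * norm b \<le> \<bar>t\<bar> * (norm b + 1)" by (simp add: mult_left_mono)
    also have "\<dots> < \<delta> * (norm b + 1)"
      using that b by (rule mult_strict_right_mono)
    also have "\<dots> = r"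
      using b by (simp add: \<delta>_def)
    finally show ?thesis by (simp add: dist_norm)
  qed
  have d1: "((\<lambda>s. v (x + s *\<^sub>R b)) has_real_derivative G (x + t *\<^sub>R b) \<bullet> b) (at t)"
    if "\<bar>t\<bar> < \<delta>" for t
    using G[OF inb[OF that]] by (rule has_real_derivative_along_line)
  have "((\<lambda>s. G (x + s *\<^sub>R b)) has_derivative (\<lambda>s. H (s *\<^sub>R b))) (at 0)"
  proof -
    have "((\<lambda>s. x + s *\<^sub>R b) has_derivative (\<lambda>s. s *\<^sub>R b)) (at 0)"
      by (auto intro!: derivative_eq_intros)
    then show ?thesis
      by (rule has_derivative_compose) (simp add: H)
  qed
  then have "((\<lambda>s. G (x + s *\<^sub>R b) \<bullet> b) has_derivative (\<lambda>s. H (s *\<^sub>R b) \<bullet> b)) (at 0)"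
    by (rule has_derivative_inner_left)
  moreover have "H (s *\<^sub>R b) \<bullet> b = (H b \<bullet> b) * s" for s
    using linear_scale[OF has_derivative_linear[OF H]] by simp
  ultimately have d2: "((\<lambda>s. G (x + s *\<^sub>R b) \<bullet> b) has_real_derivative H b \<bullet> b) (at 0)"
    by (simp add: has_field_derivative_def)
  have "\<bar>0\<bar> < \<delta>" using \<open>\<delta> > 0\<close> by simp
  have "G x \<bullet> b = 0"
    using DERIV_local_min[OF d1[OF \<open>\<bar>0\<bar> < \<delta>\<close>] \<open>\<delta> > 0\<close>] inb min by simp
  moreover obtain \<delta>' where "\<delta>' > 0"
    and "\<And>h. 0 < h \<Longrightarrow> h < \<delta>' \<Longrightarrow> G (x + (0 + h) *\<^sub>R b) \<bullet> b < G (x + 0 *\<^sub>R b) \<bullet> b"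
    using DERIV_neg_dec_right[OF d2] neg not_le by blast
  ultimately have \<delta>': "\<And>h. 0 < h \<Longrightarrow> h < \<delta>' \<Longrightarrow> G (x + h *\<^sub>R b) \<bullet> b < 0"
    by simp
  define t where "t = min \<delta> \<delta>' / 2"
  have t: "0 < t" "t < \<delta>" "t < \<delta>'" using \<open>\<delta> > 0\<close> \<open>\<delta>' > 0\<close> by (auto simp: t_def)
  have "\<exists>z>0. z < t \<and> v (x + t *\<^sub>R b) - v (x + 0 *\<^sub>R b) = (t - 0) * (G (x + z *\<^sub>R b) \<bullet> b)"
  proof (rule MVT2[OF \<open>0 < t\<close>])
    fix s assume "0 \<le> s" "s \<le> t"
    then have "\<bar>s\<bar> < \<delta>" using t by simp
    then show "((\<lambda>s. v (x + s *\<^sub>R b)) has_real_derivative G (x + s *\<^sub>R b) \<bullet> b) (at s)"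
      by (rule d1)
  qed
  then obtain z where "0 < z" "z < t" and z: "v (x + t *\<^sub>R b) - v x = t * (G (x + z *\<^sub>R b) \<bullet> b)"
    by auto
  have "G (x + z *\<^sub>R b) \<bullet> b < 0" using \<open>0 < z\<close> \<open>z < t\<close> t by (intro \<delta>') auto
  with t have "t * (G (x + z *\<^sub>R b) \<bullet> b) < 0" by (simp add: mult_pos_neg)
  with z have "v (x + t *\<^sub>R b) < v x" by simp
  moreover have "v x \<le> v (x + t *\<^sub>R b)" using min inb t by simp
  ultimately show False by simp
qed

section \<open>Gaussian barrier, Hopf lemma and strong maximum principle\<close>

lemma GDERIV_gaussian:
  fixes x y :: "'a::euclidean_space"
  shows "GDERIV (\<lambda>x. exp (- \<alpha> * ((x - y) \<bullet> (x - y)))) x :>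
    (- 2 * \<alpha> * exp (- \<alpha> * ((x - y) \<bullet> (x - y)))) *\<^sub>R (x - y)"
  unfolding gderiv_def
  by (auto intro!: derivative_eq_intros simp: fun_eq_iff inner_commute algebra_simps)

lemma has_derivative_gradient_gaussian:
  fixes x y :: "'a::euclidean_space"
  assumes "E = exp (- \<alpha> * ((x - y) \<bullet> (x - y)))"
  shows "((\<lambda>x. (- 2 * \<alpha> * exp (- \<alpha> * ((x - y) \<bullet> (x - y)))) *\<^sub>R (x - y)) has_derivative
    (\<lambda>k. (- 2 * \<alpha> * E) *\<^sub>R k + (4 * \<alpha>\<^sup>2 * E * ((x - y) \<bullet> k)) *\<^sub>R (x - y))) (at x)"
  unfolding assms
  by (auto intro!: derivative_eq_intros simp: fun_eq_iff)
    (simp add: inner_commute algebra_simps power2_eq_square)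

text \<open>When \<open>E\<close> is the value of the Gaussian at \<open>x\<close>, the sum is its
  Laplacian, namely the trace of the derivative in \<open>has_derivative_gradient_gaussian\<close>.
  Away from \<open>y\<close> the term quadratic in \<alpha> wins for large \<alpha>, which makes the
  Gaussian a strict subsolution there.\<close>

lemma laplacian_gaussian:
  fixes x y :: "'a::euclidean_space"
  shows "(\<Sum>b\<in>Basis. ((- 2 * \<alpha> * E) *\<^sub>R b + (4 * \<alpha>\<^sup>2 * E * ((x - y) \<bullet> b)) *\<^sub>R (x - y)) \<bullet> b)
    = E * (4 * \<alpha>\<^sup>2 * ((x - y) \<bullet> (x - y)) - 2 * \<alpha> * DIM('a))"
proof -
  have "(\<Sum>b\<in>Basis. ((- 2 * \<alpha> * E) *\<^sub>R b + (4 * \<alpha>\<^sup>2 * E * ((x - y) \<bullet> b)) *\<^sub>R (x - y)) \<bullet> b)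
    = (\<Sum>b\<in>(Basis::'a set). (- 2 * \<alpha> * E) + 4 * \<alpha>\<^sup>2 * E * (((x - y) \<bullet> b) * ((x - y) \<bullet> b)))"
    by (intro sum.cong) (auto simp: inner_add_left inner_diff_left algebra_simps)
  also have "\<dots> = (- 2 * \<alpha> * E) * DIM('a) + 4 * \<alpha>\<^sup>2 * E * ((x - y) \<bullet> (x - y))"
    by (simp only: sum.distrib sum_constant sum_distrib_left[symmetric] euclidean_inner[of "x - y" "x - y"])
      simp
  finally show ?thesis by (simp add: algebra_simps)
qed

text \<open>Compare \<open>w\<close> with the barrier \<open>m * (E x - c)\<close> on the closed
  annulus \<open>A\<close> between radii \<rho>/2 and \<rho> about \<open>y\<close>. Their
  difference \<open>v\<close> is nonnegative on \<open>A\<close> and vanishes at \<open>x0\<close>,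
  so its derivative there in the inward direction \<open>y - x0\<close> is nonnegative, while that
  of the barrier is strictly positive.\<close>

lemma Hopf_boundary_point:
  fixes w :: "'a::euclidean_space \<Rightarrow> real"
  assumes "\<rho> > 0" "K \<ge> 0"
    and G: "\<And>x. x \<in> ball y \<rho> \<Longrightarrow> GDERIV w x :> G x"
    and H: "\<And>x. x \<in> ball y \<rho> \<Longrightarrow> (G has_derivative H x) (at x)"
    and lap: "\<And>x. x \<in> ball y \<rho> \<Longrightarrow> (\<Sum>b\<in>Basis. H x b \<bullet> b) \<le> K * w x"
    and cont: "continuous_on (cball y \<rho>) w"
    and pos: "\<And>x. x \<in> ball y \<rho> \<Longrightarrow> w x > 0"
    and x0: "dist y x0 = \<rho>" "w x0 = 0"
    and D: "GDERIV w x0 :> D"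
  shows "D \<bullet> (y - x0) > 0"
proof -
  define n where "n = real DIM('a)"
  define \<alpha> where "\<alpha> = max 1 ((2 * n + K + 1) / \<rho>\<^sup>2)"
  define q where "q = (\<lambda>x. (x - y) \<bullet> (x - y))"
  define E where "E = (\<lambda>x. exp (- \<alpha> * q x))"
  define c where "c = exp (- \<alpha> * \<rho>\<^sup>2)"
  have q: "q x = (dist y x)\<^sup>2" for x
    by (simp add: q_def power2_norm_eq_inner[symmetric] dist_norm norm_minus_commute)
  have "\<alpha> \<ge> 1" by (simp add: \<alpha>_def)
  have "\<alpha> * \<rho>\<^sup>2 \<ge> (2 * n + K + 1) / \<rho>\<^sup>2 * \<rho>\<^sup>2"
    by (intro mult_right_mono) (auto simp: \<alpha>_def)
  then have \<alpha>\<rho>: "\<alpha> * \<rho>\<^sup>2 \<ge> 2 * n + K + 1" using \<open>\<rho> > 0\<close> by simp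
  have barrier: "4 * \<alpha>\<^sup>2 * q x - 2 * \<alpha> * n > K" if "dist y x \<ge> \<rho> / 2" for x
  proof -
    have "q x \<ge> (\<rho> / 2)\<^sup>2"
      unfolding q using that \<open>\<rho> > 0\<close> by (intro power_mono) auto
    then have "4 * \<alpha> * q x \<ge> 4 * \<alpha> * (\<rho> / 2)\<^sup>2"
      using \<open>\<alpha> \<ge> 1\<close> by (intro mult_left_mono) auto
    then have "4 * \<alpha> * q x - 2 * n \<ge> K + 1"
      using \<alpha>\<rho> by (simp add: power2_eq_square)
    then have "1 * (K + 1) \<le> \<alpha> * (4 * \<alpha> * q x - 2 * n)"
      using \<open>\<alpha> \<ge> 1\<close> \<open>K \<ge> 0\<close> by (intro mult_mono) auto
    then show ?thesis by (simp add: algebra_simps power2_eq_square)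
  qed
  have E1: "E x \<le> 1" and E0: "E x > 0" for x
    using \<open>\<alpha> \<ge> 1\<close> by (auto simp: E_def q)
  have Ec: "E x = c" if "dist y x = \<rho>" for x using that by (simp add: E_def c_def q)
  have "c > 0" by (simp add: c_def)
  have w0: "w x \<ge> 0" if "dist y x \<le> \<rho>" for x
  proof -
    have "x \<in> closure (ball y \<rho>)" using that \<open>\<rho> > 0\<close> by simp
    moreover have "continuous_on (closure (ball y \<rho>)) w" using cont \<open>\<rho> > 0\<close> by simp
    ultimately show ?thesis
      using continuous_ge_on_closure[of "ball y \<rho>" w x 0] pos less_imp_le by blast
  qed
  \<comment> \<open>The barrier is at most \<open>m\<close> because \<open>E x - c\<close> is at
    most 1, so \<open>w\<close> dominates it on the inner sphere. On the outer sphere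
    \<open>E x = c\<close> and the barrier vanishes.\<close>
  obtain m where "m > 0" and m: "\<And>x. dist y x = \<rho> / 2 \<Longrightarrow> m \<le> w x"
  proof (cases "sphere y (\<rho> / 2) = {}")
    case True
    then show thesis using that[of 1] by (auto simp: sphere_def)
  next
    case False
    have "continuous_on (sphere y (\<rho> / 2)) w"
      using cont \<open>\<rho> > 0\<close> by (elim continuous_on_subset) auto
    with False obtain z where "z \<in> sphere y (\<rho> / 2)" "\<forall>x\<in>sphere y (\<rho> / 2). w z \<le> w x"
      using continuous_attains_inf[of "sphere y (\<rho> / 2)" w] by auto
    then show thesis using that[of "w z"] pos[of z] \<open>\<rho> > 0\<close> by (auto simp: sphere_def)
  qed
  define v where "v = (\<lambda>x. w x - m * (E x - c))"
  define A where "A = cball y \<rho> - ball y (\<rho> / 2)"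
  have "compact A" unfolding A_def by (intro compact_diff) auto
  have "x0 \<in> A" using x0 \<open>\<rho> > 0\<close> by (auto simp: A_def)
  have "continuous_on A v"
    unfolding v_def E_def q_def A_def
    by (intro continuous_intros continuous_on_subset[OF cont]) auto
  then obtain p where "p \<in> A" and p: "\<And>x. x \<in> A \<Longrightarrow> v p \<le> v x"
    using continuous_attains_inf[of A v] \<open>compact A\<close> \<open>x0 \<in> A\<close> by auto
  \<comment> \<open>A negative minimum would lie in the open annulus, where the Laplacian of
    \<open>v\<close> is nonnegative. But that Laplacian is less than \<open>K * v p\<close>, up to
    the nonnegative constant \<open>K * m * c\<close>, which would force
    \<open>K * v p > 0\<close>.\<close>
  have "v p \<ge> 0"
  proof (rule ccontr)
    assume neg: "\<not> v p \<ge> 0"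
    have "dist y p \<noteq> \<rho>"
      using neg w0[of p] Ec[of p] by (auto simp: v_def)
    moreover have "dist y p \<noteq> \<rho> / 2"
    proof
      assume "dist y p = \<rho> / 2"
      then have "w p \<ge> m" using m by simp
      moreover have "m * (E p - c) \<le> m * 1"
        using E1[of p] \<open>c > 0\<close> \<open>m > 0\<close> by (intro mult_left_mono) auto
      ultimately show False using neg by (simp add: v_def)
    qed
    ultimately have "\<rho> / 2 < dist y p" "dist y p < \<rho>" using \<open>p \<in> A\<close> by (auto simp: A_def)
    define r where "r = min (dist y p - \<rho> / 2) (\<rho> - dist y p)"
    have "r > 0" using \<open>\<rho> / 2 < dist y p\<close> \<open>dist y p < \<rho>\<close> by (simp add: r_def)
    have sub: "x \<in> A \<and> x \<in> ball y \<rho>" if "x \<in> ball p r" for x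
      using that dist_triangle[of y x p] dist_triangle[of y p x]
      by (auto simp: A_def r_def dist_commute)
    define GE where "GE = (\<lambda>x. (- 2 * \<alpha> * E x) *\<^sub>R (x - y))"
    define HE where "HE = (\<lambda>k. (- 2 * \<alpha> * E p) *\<^sub>R k + (4 * \<alpha>\<^sup>2 * E p * ((p - y) \<bullet> k)) *\<^sub>R (p - y))"
    have GE: "GDERIV E x :> GE x" for x
      using GDERIV_gaussian[of \<alpha> y x] by (simp add: E_def GE_def q_def)
    have HE: "(GE has_derivative HE) (at p)"
      using has_derivative_gradient_gaussian[of "E p" \<alpha> p y] by (simp add: E_def GE_def HE_def q_def)
    have "GDERIV v x :> G x - m *\<^sub>R GE x" if "x \<in> ball p r" for x
    proof -
      have "(w has_derivative (\<lambda>h. h \<bullet> G x)) (at x)" "(E has_derivative (\<lambda>h. h \<bullet> GE x)) (at x)"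
        using G sub that GE by (auto simp: gderiv_def)
      then have "(v has_derivative (\<lambda>h. h \<bullet> G x - m * (h \<bullet> GE x - 0))) (at x)"
        unfolding v_def by (intro derivative_intros)
      then show ?thesis by (simp add: gderiv_def inner_diff_right)
    qed
    moreover have "((\<lambda>x. G x - m *\<^sub>R GE x) has_derivative (\<lambda>k. H p k - m *\<^sub>R HE k)) (at p)"
      using H[of p] HE sub[of p] \<open>r > 0\<close> by (intro derivative_intros) auto
    ultimately have "(H p b - m *\<^sub>R HE b) \<bullet> b \<ge> 0" for b
      using \<open>r > 0\<close> p sub by (intro second_derivative_nonneg_at_local_min[of r p v]) auto
    then have "0 \<le> (\<Sum>b\<in>Basis. (H p b - m *\<^sub>R HE b) \<bullet> b)" by (intro sum_nonneg) auto
    also have "\<dots> = (\<Sum>b\<in>Basis. H p b \<bullet> b) - m * (\<Sum>b\<in>Basis. HE b \<bullet> b)"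
      by (simp add: inner_diff_left sum_subtractf sum_distrib_left)
    also have "(\<Sum>b\<in>Basis. HE b \<bullet> b) = E p * (4 * \<alpha>\<^sup>2 * q p - 2 * \<alpha> * n)"
      unfolding HE_def q_def n_def by (rule laplacian_gaussian)
    also have "(\<Sum>b\<in>Basis. H p b \<bullet> b) \<le> K * w p"
      using lap sub \<open>r > 0\<close> by simp
    finally have "0 \<le> K * w p - m * (E p * (4 * \<alpha>\<^sup>2 * q p - 2 * \<alpha> * n))" by simp
    moreover have "m * (E p * (4 * \<alpha>\<^sup>2 * q p - 2 * \<alpha> * n)) > m * (E p * K)"
      using barrier[of p] \<open>\<rho> / 2 < dist y p\<close> E0[of p] \<open>m > 0\<close> by (simp del: mult_less_cancel_left add: mult_less_cancel_left_pos)
    moreover have "K * v p = K * w p - m * (E p * K) + K * m * c"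
      by (simp add: v_def algebra_simps)
    moreover have "K * m * c \<ge> 0" using \<open>K \<ge> 0\<close> \<open>m > 0\<close> \<open>c > 0\<close> by simp
    ultimately have "K * v p > 0" by linarith
    then show False using neg \<open>K \<ge> 0\<close> by (simp add: zero_less_mult_iff)
  qed
  then have v0: "v x \<ge> 0" if "x \<in> A" for x using p[OF that] by simp
  define \<nu> where "\<nu> = y - x0"
  have "norm \<nu> = \<rho>" using x0 by (simp add: \<nu>_def dist_norm)
  have inA: "x0 + t *\<^sub>R \<nu> \<in> A" if "0 \<le> t" "t \<le> 1/2" for t
  proof -
    have "y - (x0 + t *\<^sub>R \<nu>) = (1 - t) *\<^sub>R \<nu>" by (simp add: \<nu>_def algebra_simps)
    then have "dist y (x0 + t *\<^sub>R \<nu>) = (1 - t) * \<rho>"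
      using \<open>norm \<nu> = \<rho>\<close> that by (simp add: dist_norm)
    moreover have "(1 - t) * \<rho> \<le> 1 * \<rho>" "(1 - t) * \<rho> \<ge> (1/2) * \<rho>"
      using that \<open>\<rho> > 0\<close> by (auto intro!: mult_right_mono)
    ultimately show ?thesis by (simp add: A_def)
  qed
  define F where "F = D - m *\<^sub>R ((- 2 * \<alpha> * c) *\<^sub>R (x0 - y))"
  have "GDERIV E x0 :> (- 2 * \<alpha> * c) *\<^sub>R (x0 - y)"
    using GDERIV_gaussian[of \<alpha> y x0] Ec[OF x0(1)] by (simp add: E_def q_def)
  then have "(E has_derivative (\<lambda>h. h \<bullet> ((- 2 * \<alpha> * c) *\<^sub>R (x0 - y)))) (at x0)"
    by (simp only: gderiv_def)
  moreover have "(w has_derivative (\<lambda>h. h \<bullet> D)) (at x0)"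
    using D by (simp only: gderiv_def)
  ultimately have "(v has_derivative (\<lambda>h. h \<bullet> D - m * (h \<bullet> ((- 2 * \<alpha> * c) *\<^sub>R (x0 - y)) - 0))) (at x0)"
    unfolding v_def by (intro derivative_intros)
  then have "GDERIV v x0 :> F" unfolding gderiv_def F_def
    by (rule has_derivative_eq_rhs) (simp add: fun_eq_iff inner_diff_right algebra_simps)
  then have dv: "((\<lambda>t. v (x0 + t *\<^sub>R \<nu>)) has_real_derivative F \<bullet> \<nu>) (at 0)"
    by (intro has_real_derivative_along_line) simp
  have "v x0 = 0" using x0 Ec by (simp add: v_def)
  have "F \<bullet> \<nu> \<ge> 0"
  proof (rule ccontr)
    assume "\<not> F \<bullet> \<nu> \<ge> 0"
    then obtain d where "d > 0" and d: "\<And>h. 0 < h \<Longrightarrow> h < d \<Longrightarrow> v (x0 + h *\<^sub>R \<nu>) < v x0"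
      using DERIV_neg_dec_right[OF dv] by auto
    have "v (x0 + min (1/2) (d/2) *\<^sub>R \<nu>) < v x0" using \<open>d > 0\<close> by (intro d) auto
    moreover have "v (x0 + min (1/2) (d/2) *\<^sub>R \<nu>) \<ge> 0" using \<open>d > 0\<close> by (intro v0 inA) auto
    ultimately show False using \<open>v x0 = 0\<close> by simp
  qed
  moreover have "F = D - (2 * \<alpha> * c * m) *\<^sub>R \<nu>"
    by (simp add: F_def \<nu>_def algebra_simps)
  moreover have "(2 * \<alpha> * c * m) * (\<nu> \<bullet> \<nu>) > 0"
    using \<open>\<alpha> \<ge> 1\<close> \<open>c > 0\<close> \<open>m > 0\<close> \<open>norm \<nu> = \<rho>\<close> \<open>\<rho> > 0\<close> by auto
  ultimately show ?thesis by (simp add: inner_diff_left \<nu>_def)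
qed

text \<open>If \<open>w\<close> had a zero, a ball free of zeros could be placed in \<open>S\<close>
  with a zero \<open>x0\<close> on its boundary. The Hopf lemma gives a nonzero gradient at
  \<open>x0\<close>, yet \<open>x0\<close> is an interior minimum. The constant \<open>K\<close> may
  depend on the compact set \<open>C\<close>, since a locally Lipschitz \<open>g\<close> provides no
  more.\<close>

lemma strong_maximum_principle:
  fixes w :: "'a::euclidean_space \<Rightarrow> real"
  assumes "open S" "convex S"
    and G: "\<And>x. x \<in> S \<Longrightarrow> GDERIV w x :> G x"
    and H: "\<And>x. x \<in> S \<Longrightarrow> (G has_derivative H x) (at x)"
    and lap: "\<And>C. compact C \<Longrightarrow> C \<subseteq> S \<Longrightarrow>
      \<exists>K\<ge>0. \<forall>x\<in>C. (\<Sum>b\<in>Basis. H x b \<bullet> b) \<le> K * w x"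
    and nonneg: "\<And>x. x \<in> S \<Longrightarrow> w x \<ge> 0"
    and a: "a \<in> S" "w a > 0"
    and z: "z \<in> S"
  shows "w z > 0"
proof (rule ccontr)
  assume "\<not> w z > 0"
  then have "w z = 0" using nonneg z by (simp add: order.antisym)
  have cont: "continuous_on S w"
    using G unfolding gderiv_def
    by (intro continuous_at_imp_continuous_on ballI) (blast dest: has_derivative_continuous)
  define Z where "Z = {x \<in> closed_segment a z. w x = 0}"
  have seg: "closed_segment a z \<subseteq> S" using a z \<open>convex S\<close> by (simp add: closed_segment_subset)
  have "closed Z"
    unfolding Z_def
    by (intro continuous_closed_preimage_constant continuous_on_subset[OF cont seg] closed_segment)
  then have "compact Z"
    by (rule compact_eq_bounded_closed[THEN iffD2, OF conjI, rotated])
       (auto simp: Z_def intro: bounded_subset[OF bounded_closed_segment])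
  moreover have "Z \<noteq> {}" using \<open>w z = 0\<close> by (auto simp: Z_def)
  ultimately obtain z1 where "z1 \<in> Z" and z1: "\<And>x. x \<in> Z \<Longrightarrow> dist a z1 \<le> dist a x"
    using distance_attains_inf[of Z a] \<open>closed Z\<close> by metis
  have "z1 \<in> S" "w z1 = 0" using \<open>z1 \<in> Z\<close> seg by (auto simp: Z_def)
  then have "z1 \<noteq> a" using a by auto
  obtain r where "r > 0" and r: "cball z1 r \<subseteq> S"
    using \<open>open S\<close> \<open>z1 \<in> S\<close> open_contains_cball by blast
  \<comment> \<open>Moves from \<open>z1\<close>, the zero on the segment nearest to
    \<open>a\<close>, back towards \<open>a\<close>. The new point \<open>p\<close> is not a zero
    and lies within \<open>r / 3\<close> of \<open>z1\<close>.\<close>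
  define t where "t = min (1/2) (r / (3 * dist a z1))"
  have t: "0 < t" "t \<le> 1/2" "t * dist a z1 \<le> r / 3"
  proof -
    have "dist a z1 > 0" using \<open>z1 \<noteq> a\<close> by simp
    then show "0 < t" "t \<le> 1/2" using \<open>r > 0\<close> by (auto simp: t_def)
    have "t * dist a z1 \<le> r / (3 * dist a z1) * dist a z1"
      by (intro mult_right_mono) (auto simp: t_def)
    then show "t * dist a z1 \<le> r / 3" using \<open>dist a z1 > 0\<close> by simp
  qed
  define p where "p = z1 + t *\<^sub>R (a - z1)"
  have "dist p z1 = t * dist a z1" using t by (simp add: p_def dist_norm)
  have "dist a p = (1 - t) * dist a z1"
  proof -
    have "a - p = (1 - t) *\<^sub>R (a - z1)" by (simp add: p_def algebra_simps)
    then show ?thesis using t by (simp add: dist_norm)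
  qed
  moreover have "(1 - t) * dist a z1 < 1 * dist a z1"
    using t \<open>z1 \<noteq> a\<close> by (intro mult_strict_right_mono) auto
  ultimately have "p \<notin> Z" using z1[of p] by auto
  have "p \<in> closed_segment z1 a"
    unfolding closed_segment_def using t
    by (auto simp: p_def algebra_simps intro!: exI[of _ t])
  moreover have "closed_segment z1 a \<subseteq> closed_segment a z"
    using \<open>z1 \<in> Z\<close> by (auto simp: Z_def subset_closed_segment)
  ultimately have "w p \<noteq> 0" using \<open>p \<notin> Z\<close> by (auto simp: Z_def)
  \<comment> \<open>Only zeros near \<open>z1\<close> are considered, so that they form a closed
    set. The nearest one to \<open>p\<close> is at distance \<rho> \<le> r/3 because
    \<open>z1\<close> competes, and therefore the ball of radius \<rho> about \<open>p\<close> stays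
    in \<open>cball z1 r\<close>.\<close>
  define Y where "Y = {x \<in> cball z1 r. w x = 0}"
  have "closed Y"
    unfolding Y_def
    by (intro continuous_closed_preimage_constant continuous_on_subset[OF cont r] closed_cball)
  moreover have "z1 \<in> Y" using \<open>r > 0\<close> \<open>w z1 = 0\<close> by (simp add: Y_def)
  ultimately obtain x0 where "x0 \<in> Y" and x0: "\<And>x. x \<in> Y \<Longrightarrow> dist p x0 \<le> dist p x"
    using distance_attains_inf[of Y p] by auto
  define \<rho> where "\<rho> = dist p x0"
  have "w x0 = 0" "x0 \<in> S" using \<open>x0 \<in> Y\<close> r by (auto simp: Y_def)
  have "\<rho> > 0" using \<open>w x0 = 0\<close> \<open>w p \<noteq> 0\<close> by (auto simp: \<rho>_def)
  have "\<rho> \<le> r / 3" using x0[OF \<open>z1 \<in> Y\<close>] t \<open>dist p z1 = t * dist a z1\<close> by (simp add: \<rho>_def)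
  have sub: "cball p \<rho> \<subseteq> cball z1 r"
  proof
    fix x assume "x \<in> cball p \<rho>"
    then show "x \<in> cball z1 r"
      using \<open>\<rho> \<le> r / 3\<close> t \<open>dist p z1 = t * dist a z1\<close> dist_triangle[of z1 x p] \<open>r > 0\<close>
      by (auto simp: dist_commute)
  qed
  have subS: "x \<in> S" if "x \<in> ball p \<rho>" for x using that sub r by force
  obtain K where "K \<ge> 0" and K: "\<And>x. x \<in> cball p \<rho> \<Longrightarrow> (\<Sum>b\<in>Basis. H x b \<bullet> b) \<le> K * w x"
    using lap[OF compact_cball order_trans[OF sub r]] by auto
  have "G x0 \<bullet> (p - x0) > 0"
  proof (rule Hopf_boundary_point[OF \<open>\<rho> > 0\<close> \<open>K \<ge> 0\<close>, of p w G H])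
    show "continuous_on (cball p \<rho>) w" using cont sub r by (blast intro: continuous_on_subset)
    fix x assume x: "x \<in> ball p \<rho>"
    show "GDERIV w x :> G x" "(G has_derivative H x) (at x)"
      using G H subS[OF x] by auto
    show "(\<Sum>b\<in>Basis. H x b \<bullet> b) \<le> K * w x" using K x by auto
    have "x \<notin> Y" using x x0[of x] by (auto simp: \<rho>_def)
    moreover have "x \<in> cball z1 r" using x sub by force
    ultimately have "w x \<noteq> 0" by (simp add: Y_def)
    then show "w x > 0" using nonneg[OF subS[OF x]] by simp
  qed (use \<open>w x0 = 0\<close> G \<open>x0 \<in> S\<close> in \<open>auto simp: \<rho>_def\<close>)
  moreover have "(\<lambda>h. h \<bullet> G x0) = (\<lambda>v. 0)"
    using G[OF \<open>x0 \<in> S\<close>] \<open>open S\<close> \<open>x0 \<in> S\<close> \<open>w x0 = 0\<close> nonneg unfolding gderiv_def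
    by (intro differential_zero_maxmin[of x0 S w]) auto
  ultimately show False by (metis inner_commute less_irrefl)
qed

section \<open>Reflections in hyperplanes\<close>

definition refl :: "'a::euclidean_space \<Rightarrow> real \<Rightarrow> 'a \<Rightarrow> 'a"
  where "refl e s x = x + (2 * (s - x \<bullet> e)) *\<^sub>R e"

text \<open>For s > 0 the reflection brings every point beyond the hyperplane strictly closer to the
  origin. This keeps the reflected cap inside the ball, and sends boundary points beyond the
  hyperplane to interior points.\<close>

lemma norm_refl:
  assumes "norm e = 1"
  shows "(norm (refl e s x))\<^sup>2 = (norm x)\<^sup>2 + 4 * s * (s - x \<bullet> e)"
proof -
  have "e \<bullet> e = 1" using assms by (simp add: norm_eq_1)
  then show ?thesis
    by (simp add: refl_def power2_norm_eq_inner inner_add_left inner_add_right inner_commute)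
      (simp add: algebra_simps)
qed

lemma refl_fixed: "x \<bullet> e = s \<Longrightarrow> refl e s x = x"
  by (simp add: refl_def)

lemma refl_in_ball:
  assumes "norm e = 1" "0 \<le> s" "s \<le> x \<bullet> e" "x \<in> ball 0 R"
  shows "refl e s x \<in> ball 0 R"
proof -
  have "s * (s - x \<bullet> e) \<le> 0" using assms by (simp add: mult_nonneg_nonpos)
  then have "(norm (refl e s x))\<^sup>2 \<le> (norm x)\<^sup>2" using norm_refl[OF assms(1), of s x] by simp
  then have "norm (refl e s x) \<le> norm x" by (rule power2_le_imp_le) simp
  then show ?thesis using assms by simp
qed

text \<open>The reflection is affine, and \<open>refl e 0\<close> is its linear part.\<close>

lemma has_derivative_refl: "(refl e s has_derivative refl e 0) (at x)"
proof -
  have "((\<lambda>x. x + (2 * (s - x \<bullet> e)) *\<^sub>R e) has_derivative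
      (\<lambda>h. h + (2 * (0 - h \<bullet> e)) *\<^sub>R e)) (at x)"
    by (intro derivative_eq_intros) auto
  then show ?thesis unfolding refl_def by simp
qed

lemma bounded_linear_refl: "bounded_linear (refl e 0)"
  using has_derivative_bounded_linear[OF has_derivative_refl] .

lemma refl_inner_commute: "refl e 0 a \<bullet> b = a \<bullet> refl e 0 b"
  by (simp add: refl_def inner_diff_left inner_diff_right inner_commute)

lemma GDERIV_reflected_difference:
  assumes "GDERIV u x :> D" "GDERIV u (refl e s x) :> D'"
  shows "GDERIV (\<lambda>x. u x - u (refl e s x)) x :> D - refl e 0 D'"
proof -
  have "((\<lambda>x. u (refl e s x)) has_derivative (\<lambda>h. refl e 0 h \<bullet> D')) (at x)"
    using has_derivative_refl assms(2) unfolding gderiv_def by (rule has_derivative_compose)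
  then have "((\<lambda>x. u x - u (refl e s x)) has_derivative (\<lambda>h. h \<bullet> D - refl e 0 h \<bullet> D')) (at x)"
    using assms(1) unfolding gderiv_def by (intro has_derivative_diff)
  then show ?thesis
    by (simp add: gderiv_def inner_diff_right refl_inner_commute)
qed

lemma has_derivative_reflected_difference:
  assumes "(G has_derivative H) (at x)" "(G has_derivative H') (at (refl e s x))"
  shows "((\<lambda>x. G x - refl e 0 (G (refl e s x))) has_derivative
    (\<lambda>k. H k - refl e 0 (H' (refl e 0 k)))) (at x)"
proof -
  have "((\<lambda>x. G (refl e s x)) has_derivative (\<lambda>h. H' (refl e 0 h))) (at x)"
    using has_derivative_refl assms(2) by (rule has_derivative_compose)
  then show ?thesis
    using assms(1) by (intro has_derivative_diff bounded_linear.has_derivative[OF bounded_linear_refl])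
qed

text \<open>Conjugation by an orthogonal involution preserves the trace; this is the invariance of
  the Laplacian under reflection. In the expansion the two cross terms contribute -2
  (\<open>H e \<bullet> e\<close>) each and the last term +4 (\<open>H e \<bullet> e\<close>),
  because \<open>e\<close> has length 1.\<close>

lemma trace_reflected:
  fixes H :: "'a::euclidean_space \<Rightarrow> 'a"
  assumes "linear H" "norm e = 1"
  shows "(\<Sum>b\<in>Basis. refl e 0 (H (refl e 0 b)) \<bullet> b) = (\<Sum>b\<in>Basis. H b \<bullet> b)"
proof -
  have e: "e \<bullet> e = 1" using assms by (simp add: norm_eq_1)
  have "H e = (\<Sum>b\<in>Basis. (e \<bullet> b) *\<^sub>R H b)"
    by (subst euclidean_representation[of e, symmetric])
      (simp only: linear_sum[OF assms(1)] linear_scale[OF assms(1)])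
  then have 1: "H e \<bullet> e = (\<Sum>b\<in>Basis. (e \<bullet> b) * (H b \<bullet> e))"
    by (simp add: inner_sum_left)
  have 2: "H e \<bullet> e = (\<Sum>b\<in>Basis. (e \<bullet> b) * (H e \<bullet> b))"
    by (subst euclidean_inner) (simp add: mult.commute)
  have 3: "1 = (\<Sum>b\<in>Basis. (e \<bullet> b) * (e \<bullet> b))"
    using euclidean_inner[of e e] e by simp
  have "refl e 0 (H (refl e 0 b)) \<bullet> b =
      H b \<bullet> b - 2 * ((e \<bullet> b) * (H b \<bullet> e)) - 2 * ((e \<bullet> b) * (H e \<bullet> b))
        + (4 * (H e \<bullet> e)) * ((e \<bullet> b) * (e \<bullet> b))" for b
  proof -
    have "H (refl e 0 b) = H b - (2 * (e \<bullet> b)) *\<^sub>R H e"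
      by (simp add: refl_def linear_diff[OF assms(1)] linear_scale[OF assms(1)] inner_commute)
    moreover have "refl e 0 b = b - (2 * (e \<bullet> b)) *\<^sub>R e"
      by (simp add: refl_def inner_commute)
    ultimately show ?thesis
      by (simp only: refl_inner_commute) (simp add: inner_diff_left inner_diff_right algebra_simps)
  qed
  then have "(\<Sum>b\<in>Basis. refl e 0 (H (refl e 0 b)) \<bullet> b) =
      (\<Sum>b\<in>Basis. H b \<bullet> b) - 2 * (\<Sum>b\<in>Basis. (e \<bullet> b) * (H b \<bullet> e))
        - 2 * (\<Sum>b\<in>Basis. (e \<bullet> b) * (H e \<bullet> b))
        + (4 * (H e \<bullet> e)) * (\<Sum>b\<in>Basis. (e \<bullet> b) * (e \<bullet> b))"
    by (simp only: sum.distrib sum_subtractf sum_distrib_left)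
  then show ?thesis by (simp only: 1[symmetric] 2[symmetric] 3[symmetric])
qed

section \<open>The solution near the sphere, and the Laplacian of the reflected difference\<close>

locale large_solution_steep =
  fixes u :: "'a::euclidean_space \<Rightarrow> real" and g :: "real \<Rightarrow> real" and R :: real
  assumes R_pos: "R > 0"
    and g_lipschitz: "locally_lipschitz g"
    and large: "large_solution g R u"
    and steep: "filterlim (radial_deriv u) at_top (to_sphere R)"
    and tangential: "(\<lambda>x. norm (tangential_grad u x)) \<in> o[to_sphere R](radial_deriv u)"
begin

abbreviation "hess x \<equiv> frechet_derivative (grad u) (at x)"

lemma GDERIV_u: "x \<in> ball 0 R \<Longrightarrow> GDERIV u x :> grad u x"
  using large by (auto simp: large_solution_def classical_solution_def C2_on_def intro: GDERIV_grad)

lemma grad_has_derivative: "x \<in> ball 0 R \<Longrightarrow> (grad u has_derivative hess x) (at x)"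
  using large
  by (auto simp: large_solution_def classical_solution_def C2_on_def frechet_derivative_works[symmetric])

lemma trace_hess: "x \<in> ball 0 R \<Longrightarrow> (\<Sum>b\<in>Basis. hess x b \<bullet> b) = g (u x)"
  using large
  by (auto simp: large_solution_def classical_solution_def laplacian_def divergence_def)

lemma isCont_u: "x \<in> ball 0 R \<Longrightarrow> isCont u x"
  using GDERIV_u unfolding gderiv_def by (blast dest: has_derivative_continuous)

lemma continuous_on_u: "S \<subseteq> ball 0 R \<Longrightarrow> continuous_on S u"
  using isCont_u by (intro continuous_at_imp_continuous_on) blast

lemma u_large_near_sphere:
  obtains d where "d > 0" "\<And>x. R - d < norm x \<Longrightarrow> norm x < R \<Longrightarrow> u x > c"
proof -
  have "eventually (\<lambda>x. u x > c) (to_sphere R)"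
    using large by (simp add: large_solution_def filterlim_at_top_dense)
  then show thesis using that by (auto simp: eventually_to_sphere)
qed

text \<open>Split the gradient into its radial and tangential parts. Where
  \<open>x \<bullet> e\<close> is at least \<delta>, the radial part contributes at least \<delta>/R
  times the radial derivative to \<open>grad u x \<bullet> e\<close>, and close to the sphere the
  tangential part can cancel at most half of this. Hypotheses (i) and (ii) enter the proof
  here.\<close>

lemma grad_pos_near_sphere:
  assumes e: "norm e = 1" and "\<delta> > 0"
  obtains d where "d > 0"
    "\<And>x. R - d < norm x \<Longrightarrow> norm x < R \<Longrightarrow> \<delta> \<le> x \<bullet> e \<Longrightarrow> grad u x \<bullet> e > 0"
proof -
  have "eventually (\<lambda>x. radial_deriv u x > 0) (to_sphere R)"
    using steep by (simp add: filterlim_at_top_dense)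
  moreover have "eventually (\<lambda>x. norm (norm (tangential_grad u x)) \<le> \<delta> / (2 * R) * norm (radial_deriv u x))
      (to_sphere R)"
    using tangential \<open>\<delta> > 0\<close> R_pos by (intro landau_o.smallD) auto
  ultimately have "eventually (\<lambda>x. radial_deriv u x > 0 \<and>
      norm (tangential_grad u x) \<le> \<delta> / (2 * R) * radial_deriv u x) (to_sphere R)"
    by eventually_elim auto
  then obtain d where "d > 0" and d: "\<And>x. R - d < norm x \<Longrightarrow> norm x < R \<Longrightarrow>
      radial_deriv u x > 0 \<and> norm (tangential_grad u x) \<le> \<delta> / (2 * R) * radial_deriv u x"
    by (auto simp: eventually_to_sphere)
  show thesis
  proof (rule that[OF \<open>d > 0\<close>])
    fix x assume x: "R - d < norm x" "norm x < R" "\<delta> \<le> x \<bullet> e"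
    define \<rho> where "\<rho> = radial_deriv u x"
    have \<rho>: "\<rho> > 0" "norm (tangential_grad u x) \<le> \<delta> / (2 * R) * \<rho>"
      using d x by (auto simp: \<rho>_def)
    have "x \<noteq> 0" using x \<open>\<delta> > 0\<close> by auto
    have "grad u x = (\<rho> / norm x) *\<^sub>R x + tangential_grad u x"
      using \<open>x \<noteq> 0\<close> by (simp add: \<rho>_def radial_deriv_def tangential_grad_def power2_eq_square divide_inverse)
    then have "grad u x \<bullet> e = (\<rho> / norm x) * (x \<bullet> e) + tangential_grad u x \<bullet> e"
      by (metis inner_add_left inner_scaleR_left)
    moreover define \<kappa> where "\<kappa> = (\<rho> / R) * \<delta>"
    moreover have "(\<rho> / norm x) * (x \<bullet> e) \<ge> \<kappa>"
      unfolding \<kappa>_def using x \<open>x \<noteq> 0\<close> \<rho> \<open>\<delta> > 0\<close> R_pos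
      by (intro mult_mono divide_left_mono) auto
    moreover have "\<bar>tangential_grad u x \<bullet> e\<bar> \<le> \<kappa> / 2"
      using Cauchy_Schwarz_ineq2[of "tangential_grad u x" e] e \<rho> by (simp add: \<kappa>_def mult.commute)
    moreover have "\<kappa> > 0" using \<rho> R_pos \<open>\<delta> > 0\<close> by (simp add: \<kappa>_def)
    ultimately show "grad u x \<bullet> e > 0" by (smt (verit) field_sum_of_halves)
  qed
qed

text \<open>By invariance of the Laplacian the trace equals
  \<open>g (u x) - g (u (refl e s x))\<close>. The values of \<open>u\<close> involved fill a
  compact set, on which \<open>g\<close> has a global Lipschitz constant. The sign condition lets
  the distance of these values be replaced by their difference.\<close>

lemma reflected_difference_lap:
  assumes "norm e = 1" "compact C" "C \<subseteq> ball 0 R" "refl e s ` C \<subseteq> ball 0 R"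
  shows "\<exists>K\<ge>0. \<forall>x\<in>C. u x - u (refl e s x) \<ge> 0 \<longrightarrow>
    (\<Sum>b\<in>Basis. (hess x b - refl e 0 (hess (refl e s x) (refl e 0 b))) \<bullet> b) \<le> K * (u x - u (refl e s x))"
proof -
  define T where "T = u ` C \<union> u ` refl e s ` C"
  have "continuous_on C (refl e s)"
    using has_derivative_refl by (intro continuous_at_imp_continuous_on) (blast dest: has_derivative_continuous)
  then have "compact T"
    unfolding T_def using assms by (intro compact_Un compact_continuous_image continuous_on_u) auto
  \<comment> \<open>The constant family is restricted to a one-point parameter set, which is
    compact.\<close>
  moreover have "local_lipschitz {0::real} T (\<lambda>_. g)"
    using g_lipschitz unfolding locally_lipschitz_def by (rule local_lipschitz_subset) auto
  ultimately obtain L where L: "L-lipschitz_on T g"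
    using local_lipschitz_compact_implies_lipschitz[of "{0::real}" T "\<lambda>_. g"] by auto
  have "(\<Sum>b\<in>Basis. (hess x b - refl e 0 (hess (refl e s x) (refl e 0 b))) \<bullet> b) \<le> L * (u x - u (refl e s x))"
    if "x \<in> C" "u x - u (refl e s x) \<ge> 0" for x
  proof -
    have x: "x \<in> ball 0 R" "refl e s x \<in> ball 0 R" using that assms by auto
    have "(\<Sum>b\<in>Basis. (hess x b - refl e 0 (hess (refl e s x) (refl e 0 b))) \<bullet> b) = g (u x) - g (u (refl e s x))"
      using trace_reflected[OF has_derivative_linear[OF grad_has_derivative[OF x(2)]] assms(1)] x
      by (simp add: inner_diff_left sum_subtractf trace_hess)
    also have "\<dots> \<le> dist (g (u x)) (g (u (refl e s x)))" by (simp add: dist_real_def)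
    also have "\<dots> \<le> L * dist (u x) (u (refl e s x))"
      using that by (intro lipschitz_onD[OF L]) (auto simp: T_def)
    finally show ?thesis using that by (simp add: dist_real_def)
  qed
  then show ?thesis using lipschitz_on_nonneg[OF L] by auto
qed

section \<open>Comparison of the solution with its reflection in a cap\<close>

lemma exists_strict_point:
  assumes e: "norm e = 1" and s: "0 < s" "s < R"
  obtains a where "a \<in> ball 0 R" "s < a \<bullet> e" "u (refl e s a) < u a"
proof -
  have ee: "e \<bullet> e = 1" using e by (simp add: norm_eq_1)
  \<comment> \<open>Contains the reflections of all points \<open>t *\<^sub>R e\<close> with s \<le>
    t < R. It is a compact part of the ball since 0 < s < R, so \<open>u\<close> is bounded on it
    but blows up along the ray towards \<open>R *\<^sub>R e\<close>.\<close>
  define C where "C = (\<lambda>t. t *\<^sub>R e) ` {2 * s - R..s}"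
  have "C \<subseteq> ball 0 R" using s e by (auto simp: C_def)
  have "compact (u ` C)"
    unfolding C_def
    by (intro compact_continuous_image continuous_on_u \<open>C \<subseteq> ball 0 R\<close>[unfolded C_def] continuous_intros) auto
  then obtain M where M: "\<And>y. y \<in> u ` C \<Longrightarrow> y \<le> M"
    using compact_imp_bounded bounded_imp_bdd_above by (meson bdd_above_def)
  obtain d where "d > 0" and d: "\<And>x. R - d < norm x \<Longrightarrow> norm x < R \<Longrightarrow> u x > M"
    using u_large_near_sphere by blast
  define t where "t = max ((s + R) / 2) (R - d / 2)"
  have t: "s < t" "t < R" "R - d < t" using s \<open>d > 0\<close> by (auto simp: t_def less_max_iff_disj)
  have "u (t *\<^sub>R e) > M" using t s e by (intro d) auto
  moreover have "refl e s (t *\<^sub>R e) = (2 * s - t) *\<^sub>R e"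
    by (simp add: refl_def ee scaleR_left_distrib[symmetric])
  moreover have "(2 * s - t) *\<^sub>R e \<in> C" using t by (auto simp: C_def)
  ultimately have "u (refl e s (t *\<^sub>R e)) < u (t *\<^sub>R e)" using M by fastforce
  then show thesis using that[of "t *\<^sub>R e"] t s e ee by simp
qed

text \<open>The difference \<open>w\<close> is nonnegative in the cap and positive somewhere by
  \<open>exists_strict_point\<close>, so the strong maximum principle makes it positive throughout.
  This positivity in turn feeds the Hopf lemma at points of the hyperplane, where \<open>w\<close>
  vanishes; hence the two conclusions are proved together.\<close>

lemma
  assumes e: "norm e = 1" and s: "0 < s" "s < R"
    and ge: "\<And>x. x \<in> ball 0 R \<Longrightarrow> s < x \<bullet> e \<Longrightarrow> u (refl e s x) \<le> u x"
  shows reflection_strict: "x \<in> ball 0 R \<Longrightarrow> s < x \<bullet> e \<Longrightarrow> u (refl e s x) < u x"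
    and grad_pos_on_hyperplane: "x \<in> ball 0 R \<Longrightarrow> x \<bullet> e = s \<Longrightarrow> grad u x \<bullet> e > 0"
proof -
  define w where "w = (\<lambda>x. u x - u (refl e s x))"
  define G where "G = (\<lambda>x. grad u x - refl e 0 (grad u (refl e s x)))"
  define H where "H = (\<lambda>x k. hess x k - refl e 0 (hess (refl e s x) (refl e 0 k)))"
  define S where "S = ball 0 R \<inter> {x. s < x \<bullet> e}"
  define S' where "S' = ball 0 R \<inter> {x. s \<le> x \<bullet> e}"
  have "S \<subseteq> S'" by (auto simp: S_def S'_def)
  have refl: "refl e s x \<in> ball 0 R" if "x \<in> S'" for x
    using refl_in_ball[of e s x R] that e s by (auto simp: S'_def)
  have G: "GDERIV w x :> G x" and H: "(G has_derivative H x) (at x)" if "x \<in> S'" for x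
    using refl[OF that] that unfolding w_def G_def H_def S'_def
    by (auto intro!: GDERIV_reflected_difference has_derivative_reflected_difference
        GDERIV_u grad_has_derivative)
  have lap: "\<exists>K\<ge>0. \<forall>x\<in>C. w x \<ge> 0 \<longrightarrow> (\<Sum>b\<in>Basis. H x b \<bullet> b) \<le> K * w x"
    if "compact C" "C \<subseteq> S'" for C
  proof -
    have "C \<subseteq> ball 0 R" "refl e s ` C \<subseteq> ball 0 R" using that refl unfolding S'_def by blast+
    then show ?thesis unfolding w_def H_def using e that by (intro reflected_difference_lap)
  qed
  have "open S" unfolding S_def by (intro open_Int open_Collect_less continuous_intros) auto
  have "convex S"
    using convex_halfspace_gt[of s e] unfolding S_def by (intro convex_Int) (auto simp: inner_commute)
  obtain a where "a \<in> S" "w a > 0"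
    using exists_strict_point[OF e s] by (auto simp: S_def w_def)
  have w0: "w x \<ge> 0" if "x \<in> S" for x using ge that by (simp add: w_def S_def)
  have pos: "w x > 0" if "x \<in> S" for x
  proof (rule strong_maximum_principle[where S = S and a = a and G = G and H = H])
    fix C assume "compact C" "C \<subseteq> S"
    then show "\<exists>K\<ge>0. \<forall>x\<in>C. (\<Sum>b\<in>Basis. H x b \<bullet> b) \<le> K * w x"
      using lap[of C] w0 \<open>S \<subseteq> S'\<close> by blast
  qed (use G H \<open>S \<subseteq> S'\<close> \<open>open S\<close> \<open>convex S\<close> w0 \<open>a \<in> S\<close> \<open>w a > 0\<close> that in auto)
  then show "x \<in> ball 0 R \<Longrightarrow> s < x \<bullet> e \<Longrightarrow> u (refl e s x) < u x"
    by (simp add: S_def w_def)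
  assume x: "x \<in> ball 0 R" "x \<bullet> e = s"
  obtain r where "r > 0" and r: "cball x r \<subseteq> ball 0 R"
    using x(1) open_contains_cball_eq[OF open_ball] by blast
  \<comment> \<open>The ball of radius \<rho> about \<open>y\<close> lies in the cap and touches the
    hyperplane at \<open>x\<close>. Halving \<open>r\<close> keeps this ball inside
    \<open>cball x r\<close>.\<close>
  define \<rho> where "\<rho> = r / 2"
  define y where "y = x + \<rho> *\<^sub>R e"
  have "\<rho> > 0" using \<open>r > 0\<close> by (simp add: \<rho>_def)
  have "dist y x = \<rho>" using e \<open>\<rho> > 0\<close> by (simp add: y_def dist_norm)
  have in_ball: "z \<in> ball 0 R" if "dist y z \<le> \<rho>" for z
  proof -
    have "z \<in> cball x r"
      using that dist_triangle[of x z y] \<open>dist y x = \<rho>\<close> by (simp add: \<rho>_def dist_commute)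
    then show ?thesis using r by blast
  qed
  have ye: "y \<bullet> e = s + \<rho>" using x e by (simp add: y_def inner_add_left norm_eq_1)
  have diff: "s + \<rho> - z \<bullet> e \<le> dist y z" for z
    using Cauchy_Schwarz_ineq2[of "y - z" e] e ye by (simp add: inner_diff_left dist_norm)
  have sub: "ball y \<rho> \<subseteq> S"
  proof
    fix z assume "z \<in> ball y \<rho>"
    then show "z \<in> S" using in_ball[of z] diff[of z] by (simp add: S_def)
  qed
  have sub': "cball y \<rho> \<subseteq> S'"
  proof
    fix z assume "z \<in> cball y \<rho>"
    then show "z \<in> S'" using in_ball[of z] diff[of z] by (simp add: S'_def)
  qed
  obtain K where "K \<ge> 0" and K: "\<And>z. z \<in> cball y \<rho> \<Longrightarrow> w z \<ge> 0 \<Longrightarrow> (\<Sum>b\<in>Basis. H z b \<bullet> b) \<le> K * w z"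
    using lap[OF compact_cball sub'] by auto
  have "refl e s x = x" using x by (rule_tac refl_fixed)
  have "G x \<bullet> (y - x) > 0"
  proof (rule Hopf_boundary_point[OF \<open>\<rho> > 0\<close> \<open>K \<ge> 0\<close>, of y w G H])
    show "continuous_on (cball y \<rho>) w"
      using G sub' unfolding gderiv_def
      by (intro continuous_at_imp_continuous_on ballI) (blast dest: has_derivative_continuous)
    fix z assume z: "z \<in> ball y \<rho>"
    then have "z \<in> S" "z \<in> S'" using sub \<open>S \<subseteq> S'\<close> by auto
    then show "GDERIV w z :> G z" "(G has_derivative H z) (at z)" "w z > 0"
      using G H pos by auto
    show "(\<Sum>b\<in>Basis. H z b \<bullet> b) \<le> K * w z" using K z w0[OF \<open>z \<in> S\<close>] by auto
  next
    show "GDERIV w x :> G x" using x by (intro G) (simp add: S'_def)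
    show "w x = 0" using \<open>refl e s x = x\<close> by (simp add: w_def)
  qed (fact \<open>dist y x = \<rho>\<close>)
  \<comment> \<open>On the hyperplane the tangential components cancel in the gradient of
    \<open>w\<close>, and the component along \<open>e\<close> is doubled.\<close>
  moreover have "G x \<bullet> (y - x) = \<rho> * (2 * (grad u x \<bullet> e))"
    unfolding G_def y_def \<open>refl e s x = x\<close> using e
    by (simp add: refl_def inner_diff_left inner_add_left norm_eq_1)
  ultimately show "grad u x \<bullet> e > 0" using \<open>\<rho> > 0\<close> by (simp add: zero_less_mult_iff)
qed

section \<open>Moving the hyperplane\<close>

lemma reflection_limit:
  assumes e: "norm e = 1" and "0 \<le> s" and x: "x \<in> ball 0 R" "s < x \<bullet> e"
    and ge: "\<And>l. s < l \<Longrightarrow> l < x \<bullet> e \<Longrightarrow> u (refl e l x) \<le> u x"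
  shows "u (refl e s x) \<le> u x"
proof (rule tendsto_upperbound)
  have "((\<lambda>l. refl e l x) \<longlongrightarrow> refl e s x) (at_right s)"
    unfolding refl_def by (intro tendsto_intros)
  moreover have "isCont u (refl e s x)"
    using assms by (intro isCont_u refl_in_ball) auto
  ultimately show "((\<lambda>l. u (refl e l x)) \<longlongrightarrow> u (refl e s x)) (at_right s)"
    by (rule isCont_tendsto_compose[rotated])
  show "eventually (\<lambda>l. u (refl e l x) \<le> u x) (at_right s)"
    using x ge by (intro eventually_at_rightI[of s "x \<bullet> e"]) auto
qed simp

lemma moving_plane:
  assumes e: "norm e = 1" and "0 < s0" and x0: "x0 \<in> ball 0 R" "s0 < x0 \<bullet> e"
  shows "u (refl e s0 x0) < u x0"
proof (rule ccontr)
  assume contra: "\<not> u (refl e s0 x0) < u x0"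
  have le_norm: "x \<bullet> e \<le> norm x" for x
    using Cauchy_Schwarz_ineq2[of x e] e by simp
  \<comment> \<open>Positions at which the strict inequality fails, so equality counts as a
    failure.\<close>
  define B where "B = {l. 0 < l \<and> (\<exists>x\<in>ball 0 R. l < x \<bullet> e \<and> u x \<le> u (refl e l x))}"
  define s where "s = Sup B"
  have "s0 \<in> B" using assms contra by (auto simp: B_def not_less)
  have B_R: "l < R" if "l \<in> B" for l
  proof -
    from that obtain x where "x \<in> ball 0 R" "l < x \<bullet> e" by (auto simp: B_def)
    then show ?thesis using le_norm[of x] by simp
  qed
  then have bdd: "bdd_above B" by (intro bdd_aboveI[of _ R]) (auto intro: less_imp_le)
  have B_s: "l \<le> s" if "l \<in> B" for l unfolding s_def using that bdd by (rule cSup_upper)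
  have "0 < s" using B_s[OF \<open>s0 \<in> B\<close>] \<open>0 < s0\<close> by simp
  have "s \<le> R" unfolding s_def
    using \<open>s0 \<in> B\<close> B_R by (intro cSup_least) (auto intro: less_imp_le)
  \<comment> \<open>No position beyond \<open>s\<close> is bad, so the weak inequality at
    \<open>s\<close> follows by letting the hyperplane move back to \<open>s\<close>. If
    \<open>s = R\<close> the cap is empty.\<close>
  have good: "u (refl e s x) \<le> u x" if "x \<in> ball 0 R" "s < x \<bullet> e" for x
  proof (rule reflection_limit[OF e _ that])
    fix l assume "s < l" "l < x \<bullet> e"
    then have "l \<notin> B" using B_s by force
    then show "u (refl e l x) \<le> u x"
      using \<open>s < l\<close> \<open>0 < s\<close> \<open>l < x \<bullet> e\<close> that by (auto simp: B_def)
  qed (use \<open>0 < s\<close> in simp)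
  \<comment> \<open>Bad positions converging to the supremum from below, each with a witness in its
    cap. The supremum may itself be bad, hence \<open>l \<le> s\<close>.\<close>
  have "\<forall>n. \<exists>l x. s - 1 / real (Suc n) < l \<and> l \<le> s \<and> 0 < l \<and> x \<in> ball 0 R \<and> l < x \<bullet> e \<and> u x \<le> u (refl e l x)"
  proof
    fix n
    have "s - 1 / real (Suc n) < Sup B" by (simp add: s_def)
    then obtain l where "l \<in> B" "s - 1 / real (Suc n) < l"
      using less_cSupD[of B "s - 1 / real (Suc n)"] \<open>s0 \<in> B\<close> by blast
    with B_s show "\<exists>l x. s - 1 / real (Suc n) < l \<and> l \<le> s \<and> 0 < l \<and> x \<in> ball 0 R \<and> l < x \<bullet> e \<and> u x \<le> u (refl e l x)"
      unfolding B_def by blast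
  qed
  then obtain \<mu> \<xi> where \<mu>: "\<And>n. s - 1 / real (Suc n) < \<mu> n" "\<And>n. \<mu> n \<le> s" "\<And>n. 0 < \<mu> n"
    and \<xi>: "\<And>n. \<xi> n \<in> ball 0 R" "\<And>n. \<mu> n < \<xi> n \<bullet> e" "\<And>n. u (\<xi> n) \<le> u (refl e (\<mu> n) (\<xi> n))"
    unfolding choice_iff by blast
  have "\<mu> \<longlonglongrightarrow> s"
  proof (rule tendsto_sandwich)
    show "(\<lambda>n. s - 1 / real (Suc n)) \<longlonglongrightarrow> s"
      using tendsto_diff[OF tendsto_const LIMSEQ_inverse_real_of_nat, of s]
      by (simp add: inverse_eq_divide)
    show "eventually (\<lambda>n. s - 1 / real (Suc n) \<le> \<mu> n) sequentially"
      using \<mu>(1) by (intro always_eventually allI less_imp_le)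
    show "eventually (\<lambda>n. \<mu> n \<le> s) sequentially"
      using \<mu>(2) by (intro always_eventually allI)
  qed simp
  have "\<And>n. \<xi> n \<in> cball 0 R" using \<xi>(1) by (simp add: less_imp_le)
  then obtain l r where "strict_mono r" and lim: "(\<xi> \<circ> r) \<longlonglongrightarrow> l"
    using seq_compactE[OF compact_imp_seq_compact[OF compact_cball]] by metis
  define X where "X = \<xi> \<circ> r"
  define \<Lambda> where "\<Lambda> = \<mu> \<circ> r"
  define Y where "Y = (\<lambda>n. refl e (\<Lambda> n) (X n))"
  have X: "X \<longlonglongrightarrow> l" using lim by (simp add: X_def)
  have \<Lambda>: "\<Lambda> \<longlonglongrightarrow> s"
    unfolding \<Lambda>_def using \<open>\<mu> \<longlonglongrightarrow> s\<close> \<open>strict_mono r\<close> by (rule LIMSEQ_subseq_LIMSEQ)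
  have Y: "Y \<longlonglongrightarrow> refl e s l"
    unfolding Y_def refl_def by (intro tendsto_intros X \<Lambda>)
  have Xn: "X n \<in> ball 0 R" "\<Lambda> n < X n \<bullet> e" "u (X n) \<le> u (Y n)" "0 < \<Lambda> n" for n
    using \<xi> \<mu> by (auto simp: X_def \<Lambda>_def Y_def)
  have Yn: "Y n \<in> ball 0 R" for n
    unfolding Y_def using e Xn[of n] by (intro refl_in_ball) auto
  have "norm l \<le> R"
    using Xn(1) by (intro LIMSEQ_le_const2[OF tendsto_norm[OF X]]) (auto intro: less_imp_le)
  have "s \<le> l \<bullet> e"
    using Xn(2) by (intro LIMSEQ_le[OF \<Lambda> tendsto_inner[OF X tendsto_const]]) (auto intro: less_imp_le)
  with \<open>norm l \<le> R\<close> consider "s < l \<bullet> e" "norm l < R" | "s < l \<bullet> e" "norm l = R" | "l \<bullet> e = s"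
    by (metis order_le_less)
  then show False
  proof cases
    case 1
    then have "s < R" using le_norm[of l] by simp
    have "u (refl e s l) < u l"
      using reflection_strict[OF e \<open>0 < s\<close> \<open>s < R\<close> good] 1 by simp
    have "(\<lambda>n. u (X n)) \<longlonglongrightarrow> u l"
      by (rule isCont_tendsto_compose[OF isCont_u X]) (use 1 in simp)
    moreover have "(\<lambda>n. u (Y n)) \<longlonglongrightarrow> u (refl e s l)"
      by (rule isCont_tendsto_compose[OF isCont_u[OF refl_in_ball[OF e]] Y])
        (use 1 \<open>0 < s\<close> in auto)
    ultimately have "u l \<le> u (refl e s l)" using Xn(3) by (intro LIMSEQ_le) auto
    with \<open>u (refl e s l) < u l\<close> show False by simp
  next
    case 2
    \<comment> \<open>The reflected limit point is interior, so \<open>u (Y n)\<close> stays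
      bounded, while \<open>X n\<close> approaches the sphere and \<open>u (X n)\<close> exceeds
      every bound.\<close>
    have "s * (s - l \<bullet> e) < 0" using 2 \<open>0 < s\<close> by (simp add: mult_pos_neg)
    then have "(norm (refl e s l))\<^sup>2 < R\<^sup>2" using norm_refl[OF e, of s l] 2 by simp
    then have "norm (refl e s l) < R" using R_pos by (simp add: power2_less_imp_less)
    then have "(\<lambda>n. u (Y n)) \<longlonglongrightarrow> u (refl e s l)"
      by (intro isCont_tendsto_compose[OF isCont_u Y]) simp
    then have "eventually (\<lambda>n. u (Y n) < u (refl e s l) + 1) sequentially"
      by (rule order_tendstoD) simp
    moreover obtain d where "d > 0"
      and d: "\<And>x. R - d < norm x \<Longrightarrow> norm x < R \<Longrightarrow> u x > u (refl e s l) + 1"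
      using u_large_near_sphere by blast
    have "eventually (\<lambda>n. R - d < norm (X n)) sequentially"
      using tendsto_norm[OF X] 2 \<open>d > 0\<close> by (intro order_tendstoD(1)[of _ R]) auto
    ultimately have "eventually (\<lambda>n. False) sequentially"
    proof eventually_elim
      case (elim n)
      then show False using d[of "X n"] Xn(1,3)[of n] by simp
    qed
    then show False by simp
  next
    case 3
    obtain \<eta> where "\<eta> > 0" and \<eta>: "\<And>z. z \<in> ball 0 R \<Longrightarrow> dist l z < \<eta> \<Longrightarrow> grad u z \<bullet> e > 0"
    proof (cases "norm l = R")
      case True
      \<comment> \<open>Points within \<open>s / 2\<close> of \<open>l\<close> satisfy
        \<open>z \<bullet> e\<close> \<ge> s/2 because \<open>l \<bullet> e = s\<close>, so the
        estimate near the sphere applies with \<delta> = s/2.\<close>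
      have "s / 2 > 0" using \<open>0 < s\<close> by simp
      then obtain d where "d > 0"
        and d: "\<And>x. R - d < norm x \<Longrightarrow> norm x < R \<Longrightarrow> s / 2 \<le> x \<bullet> e \<Longrightarrow> grad u x \<bullet> e > 0"
        using grad_pos_near_sphere[OF e] by blast
      show thesis
      proof (rule that[of "min d (s / 2)"])
        show "min d (s / 2) > 0" using \<open>d > 0\<close> \<open>0 < s\<close> by simp
        fix z :: 'a assume z: "z \<in> ball 0 R" "dist l z < min d (s / 2)"
        have "norm l - norm z \<le> dist l z" by (simp add: dist_norm norm_triangle_ineq2)
        moreover have "l \<bullet> e - z \<bullet> e \<le> dist l z"
          using le_norm[of "l - z"] by (simp add: dist_norm inner_diff_left)
        ultimately show "grad u z \<bullet> e > 0" using z True 3 by (intro d) auto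
      qed
    next
      case False
      then have l: "l \<in> ball 0 R" using \<open>norm l \<le> R\<close> by simp
      then have "s < R" using 3 le_norm[of l] by simp
      have "grad u l \<bullet> e > 0"
        using grad_pos_on_hyperplane[OF e \<open>0 < s\<close> \<open>s < R\<close> good l 3] by simp
      have "isCont (\<lambda>z. grad u z \<bullet> e) l"
        using has_derivative_continuous[OF grad_has_derivative[OF l]] by (intro continuous_intros)
      then have "eventually (\<lambda>z. grad u z \<bullet> e > 0) (at l)"
        unfolding continuous_at by (rule order_tendstoD(1)) fact
      then have "eventually (\<lambda>z. grad u z \<bullet> e > 0) (nhds l)"
        using \<open>grad u l \<bullet> e > 0\<close> by (simp add: eventually_nhds_conv_at)
      then show thesis using that by (auto simp: eventually_nhds_metric dist_commute)
    qed
    \<comment> \<open>Both \<open>X n\<close> and its reflection \<open>Y n\<close> tend to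
      \<open>l\<close>. The segment from \<open>Y n\<close> to \<open>X n\<close> is parallel to
      \<open>e\<close> and, by convexity, stays where \<open>grad u\<close> has positive component
      along \<open>e\<close>; so \<open>u (Y n) < u (X n)\<close>, against the choice of
      \<open>X n\<close>.\<close>
    have "refl e s l = l" using 3 by (rule refl_fixed)
    then have "eventually (\<lambda>n. dist (X n) l < \<eta>) sequentially" "eventually (\<lambda>n. dist (Y n) l < \<eta>) sequentially"
      using tendstoD[OF X \<open>\<eta> > 0\<close>] tendstoD[OF Y \<open>\<eta> > 0\<close>] by auto
    then have "eventually (\<lambda>n. dist (X n) l < \<eta> \<and> dist (Y n) l < \<eta>) sequentially"
      by eventually_elim simp
    then obtain n where n: "dist (X n) l < \<eta>" "dist (Y n) l < \<eta>"
      using eventually_happens'[OF sequentially_bot] by blast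
    define t where "t = 2 * (X n \<bullet> e - \<Lambda> n)"
    have "t > 0" using Xn(2)[of n] by (simp add: t_def)
    have XY: "X n = Y n + t *\<^sub>R e"
      by (simp add: Y_def refl_def t_def algebra_simps)
    have seg: "Y n + \<tau> *\<^sub>R e \<in> ball 0 R \<and> dist l (Y n + \<tau> *\<^sub>R e) < \<eta>" if "0 \<le> \<tau>" "\<tau> \<le> t" for \<tau>
    proof -
      have "Y n + \<tau> *\<^sub>R e = (1 - \<tau> / t) *\<^sub>R Y n + (\<tau> / t) *\<^sub>R X n"
        using \<open>t > 0\<close> by (simp add: XY algebra_simps)
      then have *: "Y n + \<tau> *\<^sub>R e \<in> closed_segment (Y n) (X n)"
        unfolding closed_segment_def using that \<open>t > 0\<close> by (auto intro!: exI[of _ "\<tau> / t"])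
      have "closed_segment (Y n) (X n) \<subseteq> ball 0 R \<inter> ball l \<eta>"
        using n Xn(1) Yn by (intro closed_segment_subset convex_Int) (auto simp: dist_commute)
      with * show ?thesis by auto
    qed
    have "u (Y n) < u (Y n + t *\<^sub>R e)"
    proof (rule increasing_along_segment[OF \<open>t > 0\<close>])
      fix \<tau> assume "0 \<le> \<tau>" "\<tau> \<le> t"
      note \<tau> = seg[OF this]
      show "GDERIV u (Y n + \<tau> *\<^sub>R e) :> grad u (Y n + \<tau> *\<^sub>R e)" using \<tau> by (intro GDERIV_u) simp
      show "grad u (Y n + \<tau> *\<^sub>R e) \<bullet> e > 0" using \<tau> by (intro \<eta>) auto
    qed
    then show False using Xn(3)[of n] XY by simp
  qed
qed

section \<open>Radial symmetry and the sign of the radial derivative\<close>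

lemma radial: "radial_on (ball 0 R) u"
proof -
  have le: "u y \<le> u x" if "x \<in> ball 0 R" "y \<in> ball 0 R" "norm x = norm y" "x \<noteq> y" for x y
  proof -
    \<comment> \<open>Since \<open>x\<close> and \<open>y\<close> have equal norms, their
      perpendicular bisector passes through the origin and the reflection in it maps
      \<open>x\<close> to \<open>y\<close>. Strict inequalities at positions l > 0 pass to the weak
      one at 0, and exchanging \<open>x\<close> and \<open>y\<close> gives equality.\<close>
    define e where "e = (x - y) /\<^sub>R norm (x - y)"
    have n: "norm (x - y) > 0" using \<open>x \<noteq> y\<close> by simp
    have e: "norm e = 1" using n by (simp add: e_def)
    have "x \<bullet> x = y \<bullet> y" using that(3) by (simp add: norm_eq)
    then have "2 * (x \<bullet> (x - y)) = (norm (x - y))\<^sup>2"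
      by (simp add: power2_norm_eq_inner inner_diff_left inner_diff_right inner_commute)
    then have xe: "2 * (x \<bullet> e) = norm (x - y)"
      unfolding e_def inner_scaleR_right using n by (simp add: power2_eq_square field_simps)
    then have "refl e 0 x = x - norm (x - y) *\<^sub>R e" by (simp add: refl_def)
    then have "refl e 0 x = y" using n by (simp add: e_def)
    moreover have "u (refl e 0 x) \<le> u x"
    proof (rule reflection_limit[OF e order_refl \<open>x \<in> ball 0 R\<close>])
      show "0 < x \<bullet> e" using xe n by linarith
      fix l assume "0 < l" "l < x \<bullet> e"
      then show "u (refl e l x) \<le> u x"
        using moving_plane[OF e _ \<open>x \<in> ball 0 R\<close>] by (intro less_imp_le)
    qed
    ultimately show ?thesis by simp
  qed
  show ?thesis
    unfolding radial_on_def
  proof (intro ballI impI)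
    fix x y :: 'a assume "x \<in> ball 0 R" "y \<in> ball 0 R" "norm x = norm y"
    then show "u x = u y" using le by (metis order.antisym)
  qed
qed

lemma radial_deriv_pos:
  assumes "x \<in> ball 0 R" "x \<noteq> 0"
  shows "radial_deriv u x > 0"
proof -
  define e where "e = x /\<^sub>R norm x"
  have e: "norm e = 1" using assms by (simp add: e_def)
  have "x \<bullet> e = norm x" using assms by (simp add: e_def power2_norm_eq_inner[symmetric] power2_eq_square)
  \<comment> \<open>The hyperplane through \<open>x\<close> orthogonal to \<open>x\<close> is at
    position \<open>norm x\<close>, strictly between 0 and \<open>R\<close>, and
    \<open>moving_plane\<close> supplies the inequality in the cap beyond it.\<close>
  then have "grad u x \<bullet> e > 0"
    using assms moving_plane[OF e, of "norm x"]
    by (intro grad_pos_on_hyperplane[OF e, of "norm x"]) (auto intro: less_imp_le)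
  then show ?thesis by (simp add: radial_deriv_def e_def)
qed

end

theorem mainTheorem1:
  fixes u :: "real ^ 'n \<Rightarrow> real" and g :: "real \<Rightarrow> real" and R :: real
  assumes "CARD('n) \<ge> 2"
    and "R > 0"
    and "locally_lipschitz g"
    and "large_solution g R u"
    and "filterlim (radial_deriv u) at_top (to_sphere R)"
    and "(\<lambda>x. norm (tangential_grad u x)) \<in> o[to_sphere R](radial_deriv u)"
  shows "radial_on (ball 0 R) u \<and> (\<forall>x \<in> ball 0 R - {0}. radial_deriv u x > 0)"
proof -
  interpret large_solution_steep u g R
    using assms by unfold_locales
  show ?thesis using radial radial_deriv_pos by simp
qed

end
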